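(* Let $\mathbb{F}\subseteq\mathbb{C}$ be a subfield invariant under complex conjugation, let $m\ge 2$, and let $k_d<0<k_c$ be integers. Let $C(z),D(z)$ be $m\times m$ matrices over $\mathbb{F}[z,z^{-1}]$ of the form $$C(z)=\sum_{k=0}^{k_c}C_kz^{-k},\qquad D(z)=\sum_{k=k_d}^{0}D_kz^{-k},\qquad C_k,D_k\in gl(m,\mathbb{F}).$$ Then $(C(z),D(z))$ is a pseudoidentity matrix pair if and only if there exist a positive integer $r$, positive integers $k_1,\dots,k_r$, and nilpotent matrices $N_1,\dots,N_r\in gl(m,\mathbb{F})$ with $N_i^2=0$ for $1\le i\le r$, such that $$C(z)=L_{N_r}(z)\cdots L_{N_2}(z)L_{N_1}(z),\qquad D(z)=R_{N_r}(z)\cdots R_{N_2}(z)R_{N_1}(z),$$ where $$L_{N_i}(z)=I_m-N_i+N_iz^{-k_i},\qquad R_{N_i}(z)=I_m+N_i^{\ast}-N_i^{\ast}z^{k_i},\qquad 1\le i\le r.$$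
   Context: $gl(m,\mathbb{F})$ is the set of all $m\times m$ matrices over $\mathbb{F}$; $I_m$ is the $m\times m$ identity matrix; $A^{\ast}$ is the conjugate transpose of a constant matrix $A$. For a Laurent polynomial matrix $A(z)=\sum_k A_kz^{-k}$ (finite sum, $A_k\in gl(m,\mathbb{F})$), the adjoint is $\tilde A(z)=\sum_k A_k^{\ast}z^{k}$. A pair $(C(z),D(z))$ is called a pseudoidentity matrix pair (of rank $m$) if $C(z)=\sum_{k=0}^{k_c}C_kz^{-k}$ and $D(z)=\sum_{k=k_d}^{0}D_kz^{-k}$ for some integers $k_d\le 0\le k_c$ and matrices $C_k,D_k\in gl(m,\mathbb{F})$, and $C(z)\tilde D(z)=I_m$, $C(1)=D(1)=I_m$. *)

theory Defs
  imports "HOL-Analysis.Analysis" "HOL-Library.Poly_Mapping"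
begin

definition conj_subfield :: "complex set \<Rightarrow> bool" where
  "conj_subfield F \<longleftrightarrow>
     0 \<in> F \<and> 1 \<in> F \<and>
     (\<forall>x\<in>F. \<forall>y\<in>F. x + y \<in> F \<and> x * y \<in> F) \<and>
     (\<forall>x\<in>F. - x \<in> F \<and> inverse x \<in> F) \<and>
     (\<forall>x\<in>F. cnj x \<in> F)"

definition gl :: "complex set \<Rightarrow> (complex ^ 'n ^ 'n) set" where
  "gl F = {A. \<forall>i j. A $ i $ j \<in> F}"

definition ctrans :: "complex ^ 'n ^ 'n \<Rightarrow> complex ^ 'n ^ 'n" where
  "ctrans A = map_matrix cnj (transpose A)"

text \<open>
  A Laurent polynomial is a finitely supported function from the integers to the complex numbers
  with the convolution product; \<open>Poly_Mapping.lookup p k\<close> is the coefficient of \<open>z\<close> to the power \<open>k\<close>.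
\<close>

type_synonym laurent = "int \<Rightarrow>\<^sub>0 complex"

text \<open>\<open>monom_mat A k\<close> is the Laurent polynomial matrix \<open>A\<close> times \<open>z\<close> to the power \<open>k\<close>.\<close>

definition monom_mat :: "complex ^ 'n ^ 'n \<Rightarrow> int \<Rightarrow> laurent ^ 'n ^ 'n" where
  "monom_mat A k = map_matrix (Poly_Mapping.single k) A"

text \<open>
  Laurent polynomial matrices are expanded in powers of the inverse of \<open>z\<close>: the \<open>k\<close>-th
  coefficient matrix belongs to the power \<open>- k\<close>.
\<close>

definition coeff_mat :: "laurent ^ 'n ^ 'n \<Rightarrow> int \<Rightarrow> complex ^ 'n ^ 'n" where
  "coeff_mat A k = map_matrix (\<lambda>p. Poly_Mapping.lookup p (- k)) A"

definition adjoint_mat :: "laurent ^ 'n ^ 'n \<Rightarrow> laurent ^ 'n ^ 'n" where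
  "adjoint_mat A = (\<Sum>k | coeff_mat A k \<noteq> 0. monom_mat (ctrans (coeff_mat A k)) k)"

definition eval_mat :: "laurent ^ 'n ^ 'n \<Rightarrow> complex \<Rightarrow> complex ^ 'n ^ 'n" where
  "eval_mat A w = map_matrix (\<lambda>p. \<Sum>k\<in>Poly_Mapping.keys p. Poly_Mapping.lookup p k * w powi k) A"

definition pseudoidentity_pair ::
    "complex set \<Rightarrow> laurent ^ 'n ^ 'n \<Rightarrow> laurent ^ 'n ^ 'n \<Rightarrow> bool" where
  "pseudoidentity_pair F C D \<longleftrightarrow>
     (\<exists>kd kc :: int. \<exists>Cc Dc. kd \<le> 0 \<and> 0 \<le> kc \<and>
        (\<forall>k\<in>{0..kc}. Cc k \<in> gl F) \<and> (\<forall>k\<in>{kd..0}. Dc k \<in> gl F) \<and>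
        C = (\<Sum>k\<in>{0..kc}. monom_mat (Cc k) (- k)) \<and>
        D = (\<Sum>k\<in>{kd..0}. monom_mat (Dc k) (- k))) \<and>
     C ** adjoint_mat D = mat 1 \<and>
     eval_mat C 1 = mat 1 \<and> eval_mat D 1 = mat 1"

definition L_factor :: "complex ^ 'n ^ 'n \<Rightarrow> int \<Rightarrow> laurent ^ 'n ^ 'n" where
  "L_factor N k = monom_mat (mat 1 - N) 0 + monom_mat N (- k)"

definition R_factor :: "complex ^ 'n ^ 'n \<Rightarrow> int \<Rightarrow> laurent ^ 'n ^ 'n" where
  "R_factor N k = monom_mat (mat 1 + ctrans N) 0 - monom_mat (ctrans N) k"

text \<open>The product \<open>M r ** \<dots> ** M 2 ** M 1\<close>, with the highest index on the left.\<close>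

primrec desc_prod :: "(nat \<Rightarrow> laurent ^ 'n ^ 'n) \<Rightarrow> nat \<Rightarrow> laurent ^ 'n ^ 'n" where
  "desc_prod M 0 = mat 1"
| "desc_prod M (Suc r) = M (Suc r) ** desc_prod M r"

text \<open>The sum defining \<^const>\<open>adjoint_mat\<close> is finite.\<close>

lemma finite_coeff_mat_support: "finite {k. coeff_mat A k \<noteq> 0}"
proof -
  have "{k. coeff_mat A k \<noteq> 0} \<subseteq> (\<Union>i. \<Union>j. uminus ` Poly_Mapping.keys (A $ i $ j))"
  proof
    fix k assume "k \<in> {k. coeff_mat A k \<noteq> 0}"
    then obtain i j where "Poly_Mapping.lookup (A $ i $ j) (- k) \<noteq> 0"
      by (auto simp: coeff_mat_def map_matrix_def vec_eq_iff)
    then have "- k \<in> Poly_Mapping.keys (A $ i $ j)" by (simp add: in_keys_iff)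
    then have "k \<in> uminus ` Poly_Mapping.keys (A $ i $ j)" by (metis image_eqI minus_minus)
    then show "k \<in> (\<Union>i. \<Union>j. uminus ` Poly_Mapping.keys (A $ i $ j))" by blast
  qed
  moreover have "finite (\<Union>i. \<Union>j. uminus ` Poly_Mapping.keys (A $ i $ j))" by simp
  ultimately show ?thesis by (rule finite_subset)
qed

lemma coeff_mat_sum:
  assumes "finite K"
  shows "coeff_mat (\<Sum>k\<in>K. monom_mat (A k) (- k)) l = (if l \<in> K then A l else 0)"
  using assms
  by (auto simp: coeff_mat_def monom_mat_def vec_eq_iff lookup_sum lookup_single when_def)

lemma adjoint_mat_sum:
  assumes "finite K"
  shows "adjoint_mat (\<Sum>k\<in>K. monom_mat (A k) (- k)) = (\<Sum>k\<in>K. monom_mat (ctrans (A k)) k)"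
proof -
  have z: "monom_mat (ctrans 0) k = 0" for k
    by (simp add: monom_mat_def ctrans_def vec_eq_iff transpose_def)
  have "adjoint_mat (\<Sum>k\<in>K. monom_mat (A k) (- k))
      = (\<Sum>k\<in>{k\<in>K. A k \<noteq> 0}. monom_mat (ctrans (A k)) k)"
    unfolding adjoint_mat_def coeff_mat_sum[OF assms]
    by (intro sum.cong) auto
  also have "\<dots> = (\<Sum>k\<in>K. monom_mat (ctrans (A k)) k)"
    using assms z by (intro sum.mono_neutral_left) auto
  finally show ?thesis .
qed

end

theory Submission
  imports Defs
begin

text \<open>
  In the variable \<open>w = z\<^sup>-\<^sup>1\<close>, a pseudoidentity pair is a polynomial matrix \<open>C\<close> over \<open>F\<close> with
  polynomial inverse \<open>B = adjoint_mat D\<close>, both equal to \<open>I\<close> at \<open>w = 1\<close>. Let \<open>d j\<close> bound the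
  degree of row \<open>j\<close> of \<open>B\<close>. If some \<open>d j\<close> is positive, then the coefficient of
  highest possible degree in a suitable row of \<open>C B = I\<close> vanishes, and this is a linear relation over
  \<open>F\<close> between the leading coefficient vectors of the rows of \<open>B\<close>. Hence a row operation lowers one of
  the bounds, and finitely many row operations make \<open>B\<close> constant. Each row operation is a product of
  matrices \<open>I + N w\<^sup>k\<close> with \<open>N\<^sup>2 = 0\<close> and \<open>k \<ge> 0\<close>. For \<open>k > 0\<close> such a matrix is \<open>L_N (I + N)\<close>, and constant
  invertible factors can be moved to the right, because conjugation by a constant \<open>g\<close> turns \<open>L_N\<close>
  into the factor of \<open>g N g\<^sup>-\<^sup>1\<close>. So \<open>B\<close> is a product of factors \<open>L_N\<close> and one constant matrix, which
  is \<open>I\<close> by evaluation at \<open>1\<close>. Since the inverse of \<open>L_N\<close> is the factor of \<open>- N\<close>, also \<open>C\<close> is a product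
  of such factors, and \<open>D\<close> is determined by \<open>C\<close>.
\<close>

section \<open>Coefficient matrices of sums and products\<close>

lemma lookup_single_mult:
  "Poly_Mapping.lookup (Poly_Mapping.single k a * p) l = a * Poly_Mapping.lookup p (l - k)"
  for k l :: int and a :: "'a::comm_semiring_1"
proof -
  have "Poly_Mapping.lookup (Poly_Mapping.single k a * p) l =
      Sum_any (\<lambda>i. Poly_Mapping.lookup (Poly_Mapping.single k a) i * Sum_any (\<lambda>q. Poly_Mapping.lookup p q when l = i + q))"
    by (simp add: lookup_mult)
  also have "\<dots> = Sum_any (\<lambda>i. (a * Sum_any (\<lambda>q. Poly_Mapping.lookup p q when l = k + q)) when i = k)"
    by (rule Sum_any.cong) (auto simp: lookup_single when_def)
  also have "\<dots> = a * Sum_any (\<lambda>q. Poly_Mapping.lookup p q when l = k + q)"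
    by simp
  also have "(\<lambda>q. Poly_Mapping.lookup p q when l = k + q) = (\<lambda>q. Poly_Mapping.lookup p (l - k) when q = l - k)"
    by (auto simp: when_def)
  finally show ?thesis by simp
qed

lemma coeff_mat_eqI: "(\<And>k. coeff_mat A k = coeff_mat B k) \<Longrightarrow> A = B"
proof -
  assume a: "\<And>k. coeff_mat A k = coeff_mat B k"
  have "Poly_Mapping.lookup (A $ i $ j) l = Poly_Mapping.lookup (B $ i $ j) l" for i j l
    using a[of "- l"] by (simp add: coeff_mat_def vec_eq_iff)
  then show ?thesis by (simp add: vec_eq_iff poly_mapping_eqI)
qed

lemma coeff_mat_add [simp]: "coeff_mat (A + B) k = coeff_mat A k + coeff_mat B k"
  by (simp add: coeff_mat_def vec_eq_iff lookup_add)

lemma coeff_mat_diff [simp]: "coeff_mat (A - B) k = coeff_mat A k - coeff_mat B k"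
  by (simp add: coeff_mat_def vec_eq_iff lookup_minus)

lemma coeff_mat_0 [simp]: "coeff_mat 0 k = 0"
  by (simp add: coeff_mat_def vec_eq_iff)

lemma coeff_mat_sum_distrib: "coeff_mat (\<Sum>x\<in>S. f x) k = (\<Sum>x\<in>S. coeff_mat (f x) k)"
  by (induction S rule: infinite_finite_induct) auto

lemma coeff_mat_monom: "coeff_mat (monom_mat A k) l = (if l = - k then A else 0)"
  by (auto simp: coeff_mat_def monom_mat_def vec_eq_iff lookup_single when_def)

lemma monom_mat_0 [simp]: "monom_mat 0 k = 0"
  by (rule coeff_mat_eqI) (simp add: coeff_mat_monom)

lemma coeff_mat_one: "coeff_mat (mat 1) l = (if l = 0 then mat 1 else 0)"
  by (auto simp: coeff_mat_def mat_def vec_eq_iff lookup_one when_def)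

lemma mat_one_eq_monom: "mat 1 = monom_mat (mat 1) 0"
  by (rule coeff_mat_eqI) (simp add: coeff_mat_monom coeff_mat_one)

lemma matrix_mult_add_rdistrib: "(A + B) ** C = A ** C + B ** (C :: 'a::semiring_1 ^ 'n ^ 'm)"
  by (simp add: matrix_matrix_mult_def vec_eq_iff sum.distrib distrib_right)

lemma matrix_diff_rdistrib: "(A - B) ** C = A ** C - B ** (C :: 'a::ring_1 ^ 'n ^ 'm)"
  by (simp add: matrix_matrix_mult_def vec_eq_iff sum_subtractf left_diff_distrib)

lemma matrix_diff_ldistrib: "A ** (B - C) = A ** B - A ** (C :: 'a::ring_1 ^ 'n ^ 'm)"
  by (simp add: matrix_matrix_mult_def vec_eq_iff sum_subtractf right_diff_distrib)

lemma matrix_mult_0_left [simp]: "0 ** A = (0 :: 'a::semiring_1 ^ 'n ^ 'm)"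
  by (simp add: matrix_matrix_mult_def vec_eq_iff)

lemma matrix_mult_0_right [simp]: "A ** 0 = (0 :: 'a::semiring_1 ^ 'n ^ 'm)"
  by (simp add: matrix_matrix_mult_def vec_eq_iff)

lemma matrix_sum_rdistrib: "(\<Sum>x\<in>S. f x) ** C = (\<Sum>x\<in>S. f x ** (C :: 'a::semiring_1 ^ 'n ^ 'm))"
  by (induction S rule: infinite_finite_induct) (auto simp: matrix_mult_add_rdistrib)

lemma matrix_sum_ldistrib: "(C :: 'a::semiring_1 ^ 'n ^ 'm) ** (\<Sum>x\<in>S. f x) = (\<Sum>x\<in>S. C ** f x)"
  by (induction S rule: infinite_finite_induct) (auto simp: matrix_add_ldistrib)

lemma coeff_mat_monom_mult: "coeff_mat (monom_mat N k ** A) l = N ** coeff_mat A (l + k)"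
proof -
  have "- l - k = - (l + k)" by simp
  then show ?thesis
    by (simp add: coeff_mat_def monom_mat_def vec_eq_iff matrix_matrix_mult_def lookup_sum
        lookup_single_mult)
qed

lemma monom_mat_mult: "monom_mat A k ** monom_mat B l = monom_mat (A ** B) (k + l)"
  by (rule coeff_mat_eqI) (auto simp: coeff_mat_monom_mult coeff_mat_monom)

lemma coeff_mat_expansion:
  assumes "finite K" and "{k. coeff_mat A k \<noteq> 0} \<subseteq> K"
  shows "A = (\<Sum>k\<in>K. monom_mat (coeff_mat A k) (- k))"
proof (rule coeff_mat_eqI)
  fix k
  show "coeff_mat A k = coeff_mat (\<Sum>k\<in>K. monom_mat (coeff_mat A k) (- k)) k"
    using assms by (auto simp: coeff_mat_sum)
qed

text \<open>The index set may exceed the support of \<open>A\<close>, so that different convolution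
  sums can be brought to a common range.\<close>

lemma coeff_mat_mult:
  assumes "finite K" and "{k. coeff_mat A k \<noteq> 0} \<subseteq> K"
  shows "coeff_mat (A ** B) l = (\<Sum>k\<in>K. coeff_mat A k ** coeff_mat B (l - k))"
  by (subst coeff_mat_expansion[OF assms])
    (simp add: matrix_sum_rdistrib coeff_mat_sum_distrib coeff_mat_monom_mult)

section \<open>Evaluation at 1 is multiplicative\<close>

lemma eval_mat_1:
  assumes "finite K" and "{k. coeff_mat A k \<noteq> 0} \<subseteq> K"
  shows "eval_mat A 1 = (\<Sum>k\<in>K. coeff_mat A k)"
proof -
  have "(\<Sum>k\<in>Poly_Mapping.keys (A $ i $ j). Poly_Mapping.lookup (A $ i $ j) k) =
      (\<Sum>k\<in>K. Poly_Mapping.lookup (A $ i $ j) (- k))" for i j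
  proof -
    have "k \<in> K" if "Poly_Mapping.lookup (A $ i $ j) (- k) \<noteq> 0" for k
      using that assms(2) by (auto simp: coeff_mat_def vec_eq_iff)
    then have "Poly_Mapping.keys (A $ i $ j) \<subseteq> uminus ` K"
      by (metis (mono_tags, lifting) image_eqI in_keys_iff minus_minus subsetI)
    then have "(\<Sum>k\<in>Poly_Mapping.keys (A $ i $ j). Poly_Mapping.lookup (A $ i $ j) k) =
        (\<Sum>k\<in>uminus ` K. Poly_Mapping.lookup (A $ i $ j) k)"
      using assms(1) by (intro sum.mono_neutral_left) (auto simp: in_keys_iff)
    then show ?thesis by (simp add: sum.reindex inj_on_def)
  qed
  then show ?thesis
    by (simp add: eval_mat_def vec_eq_iff coeff_mat_def)
qed

lemma eval_mat_1_monom: "eval_mat (monom_mat N k) 1 = N"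
  by (subst eval_mat_1[of "{- k}"]) (auto simp: coeff_mat_monom)

lemma eval_mat_1_add: "eval_mat (A + B) 1 = eval_mat A 1 + eval_mat B 1"
proof -
  let ?K = "{k. coeff_mat A k \<noteq> 0} \<union> {k. coeff_mat B k \<noteq> 0}"
  have "finite ?K" by (simp add: finite_coeff_mat_support)
  then show ?thesis
    by (subst (1 2 3) eval_mat_1[of ?K]) (auto simp: sum.distrib)
qed

lemma eval_mat_1_sum: "eval_mat (\<Sum>x\<in>S. f x) 1 = (\<Sum>x\<in>S. eval_mat (f x) 1)"
proof -
  have "eval_mat 0 1 = 0" by (simp add: eval_mat_def vec_eq_iff)
  then show ?thesis
    by (induction S rule: infinite_finite_induct) (auto simp: eval_mat_1_add)
qed

lemma eval_mat_1_diff: "eval_mat (A - B) 1 = eval_mat A 1 - eval_mat B 1"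
  using eval_mat_1_add[of "A - B" B] by simp

lemma eval_mat_1_monom_mult: "eval_mat (monom_mat N k ** B) 1 = N ** eval_mat B 1"
proof -
  let ?K = "{k. coeff_mat B k \<noteq> 0}"
  have f: "finite ?K" by (simp add: finite_coeff_mat_support)
  have "l \<in> (\<lambda>l. l - k) ` ?K" if "coeff_mat (monom_mat N k ** B) l \<noteq> 0" for l
  proof (rule image_eqI)
    show "l + k \<in> ?K" using that by (auto simp: coeff_mat_monom_mult)
  qed simp
  then have "{l. coeff_mat (monom_mat N k ** B) l \<noteq> 0} \<subseteq> (\<lambda>l. l - k) ` ?K" by blast
  then have "eval_mat (monom_mat N k ** B) 1 = (\<Sum>l\<in>(\<lambda>l. l - k) ` ?K. N ** coeff_mat B (l + k))"
    using f by (simp add: eval_mat_1[of "(\<lambda>l. l - k) ` ?K"] coeff_mat_monom_mult)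
  also have "\<dots> = (\<Sum>l\<in>?K. N ** coeff_mat B l)"
    by (subst sum.reindex) (auto simp: inj_on_def)
  also have "\<dots> = N ** (\<Sum>l\<in>?K. coeff_mat B l)"
    by (simp add: matrix_sum_ldistrib)
  finally show ?thesis by (subst eval_mat_1[OF f]) auto
qed

text \<open>Expanding \<open>A\<close> into monomials leaves left factors that multiply the
  coefficients of \<open>B\<close> by a constant and shift their index; the shift is invisible in
  the sum over all coefficients.\<close>

lemma eval_mat_1_mult: "eval_mat (A ** B) 1 = eval_mat A 1 ** eval_mat B 1"
proof -
  let ?K = "{k. coeff_mat A k \<noteq> 0}"
  have f: "finite ?K" by (simp add: finite_coeff_mat_support)
  have "eval_mat (A ** B) 1 = eval_mat (\<Sum>k\<in>?K. monom_mat (coeff_mat A k) (- k) ** B) 1"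
    by (rule arg_cong[where f = "\<lambda>X. eval_mat X 1"])
      (subst matrix_sum_rdistrib[symmetric], rule arg_cong[where f = "\<lambda>X. X ** B"],
        rule coeff_mat_expansion[OF f subset_refl])
  also have "\<dots> = eval_mat A 1 ** eval_mat B 1"
    by (simp add: eval_mat_1_sum eval_mat_1_monom_mult eval_mat_1[OF f subset_refl] matrix_sum_rdistrib)
  finally show ?thesis .
qed

lemma eval_mat_1_one: "eval_mat (mat 1) 1 = mat 1"
  by (simp add: mat_one_eq_monom eval_mat_1_monom)

section \<open>The conjugate transpose and the adjoint\<close>

lemma ctrans_nth [simp]: "ctrans A $ i $ j = cnj (A $ j $ i)"
  by (simp add: ctrans_def transpose_def)

lemma ctrans_mult: "ctrans (A ** B) = ctrans B ** ctrans A"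
  by (simp add: vec_eq_iff matrix_matrix_mult_def mult.commute)

lemma ctrans_ctrans [simp]: "ctrans (ctrans A) = A"
  by (simp add: vec_eq_iff)

lemma ctrans_0 [simp]: "ctrans 0 = 0"
  by (simp add: vec_eq_iff)

lemma ctrans_one [simp]: "ctrans (mat 1) = mat 1"
  by (simp add: vec_eq_iff mat_def)

lemma ctrans_sum: "ctrans (\<Sum>x\<in>S. f x) = (\<Sum>x\<in>S. ctrans (f x))"
  by (simp add: vec_eq_iff)

lemma coeff_adjoint: "coeff_mat (adjoint_mat A) k = ctrans (coeff_mat A (- k))"
proof -
  have eq: "(k = - i) \<longleftrightarrow> (i = - k)" for i by auto
  show ?thesis
    unfolding adjoint_mat_def coeff_mat_sum_distrib coeff_mat_monom eq
    using finite_coeff_mat_support[of A] by (simp add: sum.delta)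
qed

lemma adjoint_adjoint [simp]: "adjoint_mat (adjoint_mat A) = A"
  by (rule coeff_mat_eqI) (simp add: coeff_adjoint)

lemma adjoint_mult: "adjoint_mat (A ** B) = adjoint_mat B ** adjoint_mat A"
proof (rule coeff_mat_eqI)
  fix l
  define K where "K = {k. coeff_mat A k \<noteq> 0}"
  \<comment> \<open>The substitution of \<open>l + k\<close> for \<open>k\<close> gives the
    convolution sum of the adjoints. The set \<open>K'\<close> need not contain the support of
    \<open>adjoint_mat B\<close>, so it is enlarged below by indices whose terms vanish.\<close>
  define K' where "K' = (\<lambda>k. l + k) ` K"
  have f: "finite K" by (simp add: K_def finite_coeff_mat_support)
  have "coeff_mat (adjoint_mat (A ** B)) l
      = (\<Sum>k\<in>K. ctrans (coeff_mat B (- l - k)) ** ctrans (coeff_mat A k))"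
    using f by (simp add: coeff_adjoint coeff_mat_mult[of K] K_def ctrans_sum ctrans_mult)
  also have "\<dots> = (\<Sum>k\<in>K'. coeff_mat (adjoint_mat B) k ** coeff_mat (adjoint_mat A) (l - k))"
    unfolding K'_def by (subst sum.reindex) (auto simp: inj_on_def coeff_adjoint)
  also have "\<dots> = (\<Sum>k\<in>K' \<union> {k. coeff_mat (adjoint_mat B) k \<noteq> 0}. coeff_mat (adjoint_mat B) k ** coeff_mat (adjoint_mat A) (l - k))"
  proof (rule sum.mono_neutral_left)
    show "\<forall>i\<in>K' \<union> {k. coeff_mat (adjoint_mat B) k \<noteq> 0} - K'.
        coeff_mat (adjoint_mat B) i ** coeff_mat (adjoint_mat A) (l - i) = 0"
    proof
      fix i assume "i \<in> K' \<union> {k. coeff_mat (adjoint_mat B) k \<noteq> 0} - K'"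
      then have "i - l \<notin> K" by (auto simp: K'_def image_iff)
      then show "coeff_mat (adjoint_mat B) i ** coeff_mat (adjoint_mat A) (l - i) = 0"
        by (simp add: K_def coeff_adjoint)
    qed
  qed (auto simp: K'_def f finite_coeff_mat_support)
  also have "\<dots> = coeff_mat (adjoint_mat B ** adjoint_mat A) l"
    by (subst coeff_mat_mult[of "K' \<union> {k. coeff_mat (adjoint_mat B) k \<noteq> 0}"])
      (auto simp: K'_def f finite_coeff_mat_support)
  finally show "coeff_mat (adjoint_mat (A ** B)) l = coeff_mat (adjoint_mat B ** adjoint_mat A) l" .
qed

lemma eval_mat_1_adjoint: "eval_mat (adjoint_mat A) 1 = ctrans (eval_mat A 1)"
proof -
  let ?K = "{k. coeff_mat A k \<noteq> 0}"
  have f: "finite ?K" by (simp add: finite_coeff_mat_support)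
  have "adjoint_mat A = (\<Sum>k\<in>?K. monom_mat (ctrans (coeff_mat A k)) k)"
    by (simp add: adjoint_mat_def)
  then show ?thesis
    by (simp add: eval_mat_1_sum eval_mat_1_monom eval_mat_1[OF f subset_refl] ctrans_sum)
qed

section \<open>Inverses, adjoints and values at 1 of the elementary factors\<close>

lemma L_factor_mult_inverse:
  assumes "N ** N = 0"
  shows "L_factor N k ** L_factor (- N) k = mat 1"
proof -
  \<comment> \<open>This is \<open>N (w^k - 1)\<close>, whose square vanishes with
    \<open>N ** N\<close>, so \<open>I + X\<close> and \<open>I - X\<close> are inverse to each
    other.\<close>
  define X where "X = monom_mat N (- k) - monom_mat N 0"
  have 1: "L_factor N k = mat 1 + X" "L_factor (- N) k = mat 1 - X"
    by (rule coeff_mat_eqI, simp add: L_factor_def X_def coeff_mat_monom coeff_mat_one)+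
  have "X ** X = 0"
    by (simp add: X_def matrix_diff_rdistrib matrix_diff_ldistrib monom_mat_mult assms)
  then show ?thesis
    by (simp add: 1 matrix_mult_add_rdistrib matrix_diff_ldistrib)
qed

text \<open>This ties the two products together: if \<open>N ** N = 0\<close>, then
  \<open>R_factor N k\<close> is the adjoint of the inverse of \<open>L_factor N k\<close>. Adjoint
  and inverse both reverse products, so the factors of \<open>C\<close> and \<open>D\<close> stand
  in the same order.\<close>

lemma adjoint_R_factor: "adjoint_mat (R_factor N k) = L_factor (- N) k"
proof (rule coeff_mat_eqI)
  fix l
  have "ctrans (mat 1 + ctrans N) = mat 1 + N" "ctrans (- ctrans N) = - N"
    by (auto simp: vec_eq_iff mat_def)
  \<comment> \<open>This covers \<open>k = 0\<close>, where both monomials contribute to the same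
    coefficient.\<close>
  moreover have "ctrans (mat 1 + ctrans N - ctrans N) = mat 1 + N - N" by simp
  ultimately show "coeff_mat (adjoint_mat (R_factor N k)) l = coeff_mat (L_factor (- N) k) l"
    by (auto simp: coeff_adjoint R_factor_def L_factor_def coeff_mat_monom)
qed

lemma eval_mat_1_L: "eval_mat (L_factor N k) 1 = mat 1"
  by (simp add: L_factor_def eval_mat_1_add eval_mat_1_monom)

lemma eval_mat_1_R: "eval_mat (R_factor N k) 1 = mat 1"
  by (simp add: R_factor_def eval_mat_1_add eval_mat_1_diff eval_mat_1_monom)

lemma matrix_mult_nested_inverse:
  assumes "X ** Y = mat 1" "A ** B = mat 1"
  shows "(A ** X) ** (Y ** B) = mat 1"
proof -
  have "(A ** X) ** (Y ** B) = A ** (X ** Y) ** B" by (simp add: matrix_mul_assoc)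
  then show ?thesis by (simp add: assms)
qed

lemma matrix_left_inverse_eq_right_inverse:
  assumes "X ** A = mat 1" "A ** Y = mat 1"
  shows "X = Y"
proof -
  have "X ** (A ** Y) = (X ** A) ** Y" by (rule matrix_mul_assoc)
  then show ?thesis by (simp add: assms)
qed

section \<open>Matrices over the subfield \<open>F\<close>, and products of factors
  \<open>L_N\<close> and constants over it\<close>

lemma gl_0: "conj_subfield F \<Longrightarrow> 0 \<in> gl F"
  by (simp add: gl_def conj_subfield_def)

lemma gl_one: "conj_subfield F \<Longrightarrow> mat 1 \<in> gl F"
  by (simp add: gl_def conj_subfield_def mat_def)

lemma gl_add: "conj_subfield F \<Longrightarrow> A \<in> gl F \<Longrightarrow> B \<in> gl F \<Longrightarrow> A + B \<in> gl F"
  by (simp add: gl_def conj_subfield_def)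

lemma gl_uminus: "conj_subfield F \<Longrightarrow> A \<in> gl F \<Longrightarrow> - A \<in> gl F"
  by (simp add: gl_def conj_subfield_def)

lemma gl_diff: "conj_subfield F \<Longrightarrow> A \<in> gl F \<Longrightarrow> B \<in> gl F \<Longrightarrow> A - B \<in> gl F"
  using gl_add[of F A "- B"] gl_uminus[of F B] by simp

lemma gl_sum: "conj_subfield F \<Longrightarrow> (\<And>x. x \<in> S \<Longrightarrow> f x \<in> gl F) \<Longrightarrow> (\<Sum>x\<in>S. f x) \<in> gl F"
  by (induction S rule: infinite_finite_induct) (auto simp: gl_add gl_0)

lemma gl_mult:
  assumes "conj_subfield F" "A \<in> gl F" "B \<in> gl F"
  shows "A ** B \<in> gl F"
proof -
  have "(\<Sum>x\<in>S. f x) \<in> F" if "\<And>x. x \<in> S \<Longrightarrow> f x \<in> F" for S and f :: "'a \<Rightarrow> complex"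
    using that assms(1)
    by (induction S rule: infinite_finite_induct) (auto simp: conj_subfield_def)
  then show ?thesis
    using assms by (simp add: gl_def matrix_matrix_mult_def conj_subfield_def)
qed

lemma gl_ctrans: "conj_subfield F \<Longrightarrow> A \<in> gl F \<Longrightarrow> ctrans A \<in> gl F"
  by (simp add: gl_def conj_subfield_def)

text \<open>An inductive set allows induction on products without indexing the factors;
  \<open>L_products_desc_prod\<close> restores the indices. The empty product is included.\<close>

inductive_set L_products :: "complex set \<Rightarrow> (laurent ^ 'n ^ 'n) set" for F where
  one: "mat 1 \<in> L_products F"
| L: "\<lbrakk>N \<in> gl F; N ** N = 0; 0 < k; X \<in> L_products F\<rbrakk> \<Longrightarrow> L_factor N k ** X \<in> L_products F"

lemma L_products_mult: "X \<in> L_products F \<Longrightarrow> Y \<in> L_products F \<Longrightarrow> X ** Y \<in> L_products F"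
  by (induction rule: L_products.induct)
    (auto simp: matrix_mul_assoc[symmetric] intro: L_products.L)

text \<open>The inverse takes the factors of the negated \<open>N\<close> in reverse order.\<close>

lemma L_products_inverse:
  assumes F: "conj_subfield F" and "X \<in> L_products F"
  shows "\<exists>Y\<in>L_products F. X ** Y = mat 1 \<and> Y ** X = mat 1"
  using assms(2)
proof induction
  case one
  then show ?case by (auto intro: L_products.one)
next
  case (L N k X)
  then obtain Y where Y: "Y \<in> L_products F" "X ** Y = mat 1" "Y ** X = mat 1" by blast
  have N: "(- N) ** (- N) = 0"
    using L.hyps by (simp add: matrix_matrix_mult_def)
  have inv: "L_factor N k ** L_factor (- N) k = mat 1" "L_factor (- N) k ** L_factor N k = mat 1"
    using L_factor_mult_inverse[OF L.hyps(2), of k] L_factor_mult_inverse[OF N, of k] by auto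
  have "L_factor (- N) k ** mat 1 \<in> L_products F"
    using L N F by (intro L_products.intros) (auto simp: gl_uminus)
  then have "Y ** L_factor (- N) k \<in> L_products F"
    using Y by (auto intro: L_products_mult)
  moreover have "(L_factor N k ** X) ** (Y ** L_factor (- N) k) = mat 1"
    by (rule matrix_mult_nested_inverse[OF Y(2) inv(1)])
  moreover have "(Y ** L_factor (- N) k) ** (L_factor N k ** X) = mat 1"
    by (rule matrix_mult_nested_inverse[OF inv(2) Y(3)])
  ultimately show ?case by blast
qed

lemma eval_mat_1_L_products: "X \<in> L_products F \<Longrightarrow> eval_mat X 1 = mat 1"
  by (induction rule: L_products.induct)
    (auto simp: eval_mat_1_one eval_mat_1_mult eval_mat_1_L)

lemma L_factor_conj:
  assumes "h ** g = mat 1"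
  shows "monom_mat g 0 ** L_factor M k = L_factor (g ** M ** h) k ** monom_mat g 0"
proof -
  have "g ** M ** h ** g = g ** M"
    using assms by (metis matrix_mul_assoc matrix_mul_rid)
  then show ?thesis
    by (intro coeff_mat_eqI) (auto simp: L_factor_def matrix_add_ldistrib matrix_mult_add_rdistrib monom_mat_mult
        matrix_diff_ldistrib matrix_diff_rdistrib coeff_mat_monom)
qed

text \<open>The rule \<open>g L_N = L_{gNh} g\<close> is applied factor by factor;
  \<open>g ** N ** h\<close> again squares to zero because \<open>h ** g\<close> cancels in the
  middle. This lets a constant pass to the right of a product.\<close>

lemma L_products_conj:
  assumes F: "conj_subfield F" and gh: "g \<in> gl F" "h \<in> gl F" "h ** g = mat 1"
    and "X \<in> L_products F"
  shows "\<exists>Y\<in>L_products F. monom_mat g 0 ** X = Y ** monom_mat g 0"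
  using assms(5)
proof induction
  case one
  have "monom_mat g 0 ** mat 1 = mat 1 ** monom_mat g 0" by simp
  then show ?case using L_products.one by blast
next
  case (L N k X)
  then obtain Y where Y: "Y \<in> L_products F" "monom_mat g 0 ** X = Y ** monom_mat g 0" by blast
  have "(g ** N ** h) ** (g ** N ** h) = g ** N ** (h ** g) ** N ** h"
    by (simp add: matrix_mul_assoc)
  also have "\<dots> = g ** (N ** N) ** h"
    by (simp add: gh matrix_mul_assoc)
  also have "\<dots> = 0" by (simp add: L.hyps)
  finally have "L_factor (g ** N ** h) k ** Y \<in> L_products F"
    using L Y gh F by (intro L_products.L) (auto intro: gl_mult)
  moreover have "monom_mat g 0 ** (L_factor N k ** X) = L_factor (g ** N ** h) k ** Y ** monom_mat g 0"
    by (metis L_factor_conj[OF gh(3)] Y(2) matrix_mul_assoc)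
  ultimately show ?case by blast
qed

text \<open>The constants are collected at the right end and may form any matrix over
  \<open>F\<close>; evaluation at 1 identifies it in the end.\<close>

definition L_const_products :: "complex set \<Rightarrow> (laurent ^ 'n ^ 'n) set" where
  "L_const_products F = {P ** monom_mat g 0 | P g. P \<in> L_products F \<and> g \<in> gl F}"

text \<open>For \<open>k > 0\<close>, \<open>I + N w^k = L_N (I + N)\<close>. The constant
  \<open>I + N\<close>, with inverse \<open>I - N\<close>, moves to the right past \<open>P\<close>
  and is absorbed into \<open>g\<close>. For \<open>k = 0\<close> the matrix is constant and no new
  factor arises.\<close>

lemma L_const_products_elementary:
  assumes F: "conj_subfield F" and N: "N \<in> gl F" "N ** N = 0" and k: "0 \<le> k"
    and X: "X \<in> L_const_products F"
  shows "(mat 1 + monom_mat N (- k)) ** X \<in> L_const_products F"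
proof -
  obtain P g where P: "P \<in> L_products F" "g \<in> gl F" "X = P ** monom_mat g 0"
    using X by (auto simp: L_const_products_def)
  have 1: "(mat 1 - N) ** (mat 1 + N) = mat 1"
    using N by (simp add: matrix_diff_rdistrib matrix_add_ldistrib)
  have mem: "mat 1 + N \<in> gl F" "mat 1 - N \<in> gl F"
    using N F by (auto intro: gl_add gl_diff gl_one)
  obtain Y where Y: "Y \<in> L_products F" "monom_mat (mat 1 + N) 0 ** P = Y ** monom_mat (mat 1 + N) 0"
    using L_products_conj[OF F mem 1 P(1)] by blast
  have 2: "monom_mat (mat 1 + N) 0 ** X = Y ** monom_mat ((mat 1 + N) ** g) 0"
  proof -
    have "monom_mat (mat 1 + N) 0 ** X = Y ** (monom_mat (mat 1 + N) 0 ** monom_mat g 0)"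
      using Y(2) by (simp add: P(3) matrix_mul_assoc)
    then show ?thesis by (simp add: monom_mat_mult)
  qed
  have g: "(mat 1 + N) ** g \<in> gl F" using F mem P by (auto intro: gl_mult)
  show ?thesis
  proof (cases "k = 0")
    case True
    have "mat 1 + monom_mat N (- k) = monom_mat (mat 1 + N) 0"
      by (rule coeff_mat_eqI) (simp add: True coeff_mat_monom coeff_mat_one)
    then show ?thesis using 2 Y(1) g by (auto simp: L_const_products_def)
  next
    case False
    have "mat 1 + monom_mat N (- k) = L_factor N k ** monom_mat (mat 1 + N) 0"
      by (rule coeff_mat_eqI) (simp add: L_factor_def matrix_mult_add_rdistrib monom_mat_mult
          1 matrix_add_ldistrib matrix_diff_rdistrib N coeff_mat_monom coeff_mat_one)
    then have "(mat 1 + monom_mat N (- k)) ** X = (L_factor N k ** Y) ** monom_mat ((mat 1 + N) ** g) 0"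
      using 2 by (simp add: matrix_mul_assoc[symmetric])
    moreover have "L_factor N k ** Y \<in> L_products F"
      using False k N Y by (intro L_products.L) auto
    ultimately show ?thesis using g by (auto simp: L_const_products_def)
  qed
qed

section \<open>Row operations\<close>

definition elem_mat :: "'n \<Rightarrow> 'n \<Rightarrow> complex \<Rightarrow> complex ^ 'n ^ 'n" where
  "elem_mat i j a = (\<chi> r s. if r = i \<and> s = j then a else 0)"

lemma elem_mat_mult_nth: "(elem_mat i j a ** A) $ r $ c = (if r = i then a * A $ j $ c else 0)"
proof -
  have "(if r = i \<and> s = j then a else 0) * A $ s $ c = (if s = j then (if r = i then a * A $ j $ c else 0) else 0)" for s
    by simp
  then show ?thesis by (simp add: elem_mat_def matrix_matrix_mult_def)
qed

lemma elem_mat_mult_elem_mat: "j \<noteq> i \<Longrightarrow> elem_mat i j a ** elem_mat i j' b = 0"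
  by (simp add: vec_eq_iff elem_mat_mult_nth) (simp add: elem_mat_def)

lemma elem_mat_gl: "conj_subfield F \<Longrightarrow> a \<in> F \<Longrightarrow> elem_mat i j a \<in> gl F"
  by (simp add: gl_def elem_mat_def conj_subfield_def)

text \<open>Left multiplication by \<open>I + row_op i J u e\<close> adds to row \<open>i\<close>
  the rows \<open>j\<close> in \<open>J\<close>, each multiplied by
  \<open>u j * w^(e j)\<close>.\<close>

definition row_op :: "'n \<Rightarrow> 'n set \<Rightarrow> ('n \<Rightarrow> complex) \<Rightarrow> ('n \<Rightarrow> int) \<Rightarrow> laurent ^ 'n ^ 'n" where
  "row_op i J u e = (\<Sum>j\<in>J. monom_mat (elem_mat i j (u j)) (- e j))"

text \<open>The left factor has nonzero entries only in columns from \<open>J\<close>, the right one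
  only in row \<open>i\<close>, and \<open>i\<close> is not in \<open>J\<close>.\<close>

lemma row_op_mult_row_op:
  assumes "i \<notin> J"
  shows "row_op i J u e ** row_op i J' u' e' = 0"
proof -
  have "monom_mat (elem_mat i j (u j)) (- e j) ** monom_mat (elem_mat i j' (u' j')) (- e' j') = 0"
    if "j \<in> J" for j j'
  proof -
    have "j \<noteq> i" using that assms by auto
    then show ?thesis by (simp add: monom_mat_mult elem_mat_mult_elem_mat)
  qed
  then show ?thesis
    by (simp add: row_op_def matrix_sum_rdistrib matrix_sum_ldistrib)
qed

text \<open>Since products of the summands vanish, \<open>I + row_op i J u e\<close> is the product
  of the matrices that add one row each.\<close>

lemma L_const_products_row_op:
  assumes F: "conj_subfield F" and "finite J" "i \<notin> J" "\<And>j. j \<in> J \<Longrightarrow> u j \<in> F \<and> 0 \<le> e j"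
    and X: "X \<in> L_const_products F"
  shows "(mat 1 + row_op i J u e) ** X \<in> L_const_products F"
  using assms(2-4)
proof (induction J rule: finite_induct)
  case empty
  then show ?case using X by (simp add: row_op_def)
next
  case (insert j J)
  let ?E = "monom_mat (elem_mat i j (u j)) (- e j)"
  have "row_op i {j} u e ** row_op i J u e = 0"
    by (rule row_op_mult_row_op) (use insert in auto)
  then have "?E ** row_op i J u e = 0" by (simp add: row_op_def)
  moreover have "row_op i (insert j J) u e = ?E + row_op i J u e"
    using insert by (simp add: row_op_def)
  ultimately have "mat 1 + row_op i (insert j J) u e = (mat 1 + ?E) ** (mat 1 + row_op i J u e)"
    by (simp add: matrix_mult_add_rdistrib matrix_add_ldistrib algebra_simps)
  then have "(mat 1 + row_op i (insert j J) u e) ** X = (mat 1 + ?E) ** ((mat 1 + row_op i J u e) ** X)"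
    by (simp add: matrix_mul_assoc)
  also have "\<dots> \<in> L_const_products F"
    using insert F by (intro L_const_products_elementary) (auto simp: elem_mat_gl elem_mat_mult_elem_mat)
  finally show ?case .
qed

section \<open>Polynomial matrices in w over \<open>F\<close>, and reduction of their row
  degrees\<close>

definition poly_over :: "complex set \<Rightarrow> (laurent ^ 'n ^ 'n) set" where
  "poly_over F = {A. \<forall>k. coeff_mat A k \<in> gl F \<and> (k < 0 \<longrightarrow> coeff_mat A k = 0)}"

lemma poly_over_add: "conj_subfield F \<Longrightarrow> A \<in> poly_over F \<Longrightarrow> B \<in> poly_over F \<Longrightarrow> A + B \<in> poly_over F"
  by (simp add: poly_over_def gl_add)

lemma poly_over_diff: "conj_subfield F \<Longrightarrow> A \<in> poly_over F \<Longrightarrow> B \<in> poly_over F \<Longrightarrow> A - B \<in> poly_over F"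
  by (simp add: poly_over_def gl_diff)

lemma poly_over_sum_monom:
  assumes "conj_subfield F" "\<And>x. x \<in> S \<Longrightarrow> A x \<in> gl F \<and> 0 \<le> e x"
  shows "(\<Sum>x\<in>S. monom_mat (A x) (- e x)) \<in> poly_over F"
proof -
  have "monom_mat (A x) (- e x) \<in> poly_over F" if "x \<in> S" for x
    using assms(1) assms(2)[OF that] by (auto simp: poly_over_def coeff_mat_monom gl_0)
  then show ?thesis
    by (induction S rule: infinite_finite_induct)
      (auto simp: poly_over_add assms(1), auto simp: poly_over_def gl_0 assms(1))
qed

lemma poly_over_mult:
  assumes F: "conj_subfield F" and A: "A \<in> poly_over F" and B: "B \<in> poly_over F"
  shows "A ** B \<in> poly_over F"
proof -
  let ?K = "{k. coeff_mat A k \<noteq> 0}"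
  have eq: "coeff_mat (A ** B) l = (\<Sum>k\<in>?K. coeff_mat A k ** coeff_mat B (l - k))" for l
    by (rule coeff_mat_mult) (auto simp: finite_coeff_mat_support)
  have "coeff_mat A k ** coeff_mat B (l - k) = 0" if "l < 0" for k l
    using A B that by (cases "k < 0") (auto simp: poly_over_def)
  then show ?thesis
    using A B F unfolding poly_over_def by (auto simp: eq intro!: gl_sum gl_mult sum.neutral)
qed

text \<open>In row \<open>i\<close> of \<open>A\<close> and column \<open>c\<close> of
  \<open>B\<close>, the degrees are at most \<open>M - d j\<close> and \<open>d j\<close>, so degree
  \<open>M\<close> of the product is reached only by pairing the coefficients at these two
  bounds.\<close>

lemma coeff_mat_mult_top:
  assumes A: "\<And>k j. coeff_mat A k $ i $ j \<noteq> 0 \<Longrightarrow> k + d j \<le> M"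
    and B: "\<And>k j. coeff_mat B k $ j $ c \<noteq> 0 \<Longrightarrow> k \<le> d j"
  shows "coeff_mat (A ** B) M $ i $ c = (\<Sum>j\<in>UNIV. coeff_mat A (M - d j) $ i $ j * coeff_mat B (d j) $ j $ c)"
proof -
  let ?K = "{k. coeff_mat A k \<noteq> 0} \<union> range (\<lambda>j. M - d j)"
  have f: "finite ?K" by (simp add: finite_coeff_mat_support)
  have "coeff_mat (A ** B) M = (\<Sum>k\<in>?K. coeff_mat A k ** coeff_mat B (M - k))"
    by (rule coeff_mat_mult[OF f]) auto
  then have "coeff_mat (A ** B) M $ i $ c =
      (\<Sum>k\<in>?K. \<Sum>j\<in>UNIV. coeff_mat A k $ i $ j * coeff_mat B (M - k) $ j $ c)"
    by (simp add: matrix_matrix_mult_def)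
  also have "\<dots> = (\<Sum>j\<in>UNIV. \<Sum>k\<in>?K. coeff_mat A k $ i $ j * coeff_mat B (M - k) $ j $ c)"
    by (rule sum.swap)
  also have "\<dots> = (\<Sum>j\<in>UNIV. coeff_mat A (M - d j) $ i $ j * coeff_mat B (d j) $ j $ c)"
  proof (rule sum.cong[OF refl])
    fix j
    have "coeff_mat A k $ i $ j * coeff_mat B (M - k) $ j $ c = 0" if "k \<noteq> M - d j" for k
    proof (rule ccontr)
      assume "coeff_mat A k $ i $ j * coeff_mat B (M - k) $ j $ c \<noteq> 0"
      then have "k + d j \<le> M" "M - k \<le> d j" using A B by auto
      then show False using that by simp
    qed
    then have "(\<Sum>k\<in>?K. coeff_mat A k $ i $ j * coeff_mat B (M - k) $ j $ c) =
      (\<Sum>k\<in>{M - d j}. coeff_mat A k $ i $ j * coeff_mat B (M - k) $ j $ c)"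
      using f by (intro sum.mono_neutral_right) auto
    then show "(\<Sum>k\<in>?K. coeff_mat A k $ i $ j * coeff_mat B (M - k) $ j $ c) =
      coeff_mat A (M - d j) $ i $ j * coeff_mat B (d j) $ j $ c" by simp
  qed
  finally show ?thesis .
qed

text \<open>Row \<open>i\<close> of \<open>A\<close> is chosen with a nonzero entry in column
  \<open>j0\<close>. If \<open>M\<close> is the largest degree in row \<open>i\<close> after adding
  \<open>d j\<close> in column \<open>j\<close>, then \<open>M > 0\<close>, so the coefficient of
  \<open>w^M\<close> in row \<open>i\<close> of \<open>A ** B = I\<close> vanishes. The coefficients
  of row \<open>i\<close> that attain \<open>M\<close> supply \<open>v\<close>.\<close>

lemma leading_row_relation:
  fixes A B :: "laurent ^ 'n ^ 'n" and d :: "'n \<Rightarrow> nat"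
  assumes A: "A \<in> poly_over F"
    and AB: "A ** B = mat 1"
    and d: "\<And>k j c. coeff_mat B k $ j $ c \<noteq> 0 \<Longrightarrow> k \<le> int (d j)"
    and j0: "0 < d j0"
  shows "\<exists>v. (\<forall>j. v j \<in> F) \<and> (\<exists>j. v j \<noteq> 0) \<and>
    (\<forall>c. (\<Sum>j\<in>UNIV. v j * coeff_mat B (d j) $ j $ c) = 0)"
proof -
  \<comment> \<open>A one-sided inverse of a square complex matrix is two-sided, so evaluation at 1
    shows that column \<open>j0\<close> of \<open>A\<close> is not zero.\<close>
  have "eval_mat A 1 ** eval_mat B 1 = mat 1"
    by (simp add: eval_mat_1_mult[symmetric] AB eval_mat_1_one)
  then have BA: "eval_mat B 1 ** eval_mat A 1 = mat 1"
    by (simp add: matrix_left_right_inverse)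
  have "\<exists>i k. coeff_mat A k $ i $ j0 \<noteq> 0"
  proof (rule ccontr)
    assume "\<not> ?thesis"
    then have "eval_mat A 1 $ i $ j0 = 0" for i
      by (simp add: eval_mat_1[OF finite_coeff_mat_support subset_refl])
    then have "(eval_mat B 1 ** eval_mat A 1) $ j0 $ j0 = 0"
      by (simp add: matrix_matrix_mult_def)
    then show False by (simp add: BA mat_def)
  qed
  then obtain i k0 where ik: "coeff_mat A k0 $ i $ j0 \<noteq> 0" by blast
  define T where "T = (\<lambda>(k, j). k + int (d j)) ` {(k, j). coeff_mat A k $ i $ j \<noteq> 0}"
  have "{(k, j). coeff_mat A k $ i $ j \<noteq> 0} \<subseteq> {k. coeff_mat A k \<noteq> 0} \<times> UNIV"
    by auto
  then have "finite {(k, j). coeff_mat A k $ i $ j \<noteq> 0}"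
    by (rule finite_subset) (simp add: finite_coeff_mat_support)
  then have T: "finite T" by (simp add: T_def)
  have T0: "k0 + int (d j0) \<in> T" using ik by (auto simp: T_def)
  define M where "M = Max T"
  have M: "k + int (d j) \<le> M" if "coeff_mat A k $ i $ j \<noteq> 0" for k j
    unfolding M_def using T that by (intro Max_ge) (auto simp: T_def)
  have "0 \<le> k0"
  proof (rule ccontr)
    assume "\<not> 0 \<le> k0"
    then have "coeff_mat A k0 = 0" using A by (simp add: poly_over_def)
    then show False using ik by simp
  qed
  then have M0: "0 < M" using M[OF ik] j0 by simp
  have "M \<in> T" unfolding M_def using T T0 by (intro Max_in) auto
  then obtain j k where "coeff_mat A k $ i $ j \<noteq> 0" "M = k + int (d j)" by (auto simp: T_def)
  then have nz: "\<exists>j. coeff_mat A (M - int (d j)) $ i $ j \<noteq> 0" by (intro exI[of _ j]) simp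
  have "(\<Sum>j\<in>UNIV. coeff_mat A (M - int (d j)) $ i $ j * coeff_mat B (d j) $ j $ c) = 0" for c
    using coeff_mat_mult_top[of A i "\<lambda>j. int (d j)" M B c] M d M0
    by (simp add: AB coeff_mat_one)
  moreover have "coeff_mat A (M - int (d j)) $ i $ j \<in> F" for j
    using A by (simp add: poly_over_def gl_def)
  ultimately show ?thesis
    using nz by (intro exI[of _ "\<lambda>j. coeff_mat A (M - int (d j)) $ i $ j"]) blast
qed

text \<open>Induction on the sum of the \<open>d j\<close>. These are upper bounds, not exact
  degrees, so some vectors in the relation may be zero. The left inverse \<open>A\<close> is carried
  along because the relation comes from it.\<close>

lemma right_invertible_in_L_const_products:
  fixes A B :: "laurent ^ 'n ^ 'n" and d :: "'n \<Rightarrow> nat"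
  assumes F: "conj_subfield F"
    and "A \<in> poly_over F" "B \<in> poly_over F" "A ** B = mat 1"
    and "\<And>k j c. coeff_mat B k $ j $ c \<noteq> 0 \<Longrightarrow> k \<le> int (d j)"
  shows "B \<in> L_const_products F"
  using assms(2-5)
proof (induction "\<Sum>j\<in>UNIV. d j" arbitrary: A B d rule: less_induct)
  case less
  note A = less.prems(1) and B = less.prems(2) and AB = less.prems(3) and d = less.prems(4)
  have Bneg: "coeff_mat B k $ j $ c = 0" if "k < 0" for k j c
    using B that by (simp add: poly_over_def)
  show ?case
  proof (cases "\<forall>j. d j = 0")
    case True
    have "coeff_mat B k = 0" if "k \<noteq> 0" for k
    proof (rule ccontr)
      assume "coeff_mat B k \<noteq> 0"
      then obtain j c where "coeff_mat B k $ j $ c \<noteq> 0" by (auto simp: vec_eq_iff)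
      then show False using d[of k j c] Bneg[of k j c] True that by fastforce
    qed
    then have "B = mat 1 ** monom_mat (coeff_mat B 0) 0"
      by (intro coeff_mat_eqI) (simp add: coeff_mat_monom)
    moreover have "coeff_mat B 0 \<in> gl F" using B by (simp add: poly_over_def)
    ultimately show ?thesis unfolding L_const_products_def using L_products.one by blast
  next
    case False
    then obtain j0 where "0 < d j0" by auto
    then obtain v where v: "\<And>j. v j \<in> F" "\<exists>j. v j \<noteq> 0"
      and rel: "\<And>c. (\<Sum>j\<in>UNIV. v j * coeff_mat B (d j) $ j $ c) = 0"
      using leading_row_relation[OF A AB, of d j0] d by blast
    define J where "J = {j. v j \<noteq> 0}"
    have "J \<noteq> {}" using v by (auto simp: J_def)
    \<comment> \<open>Among the rows in the relation, one with the largest bound is reduced, so that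
      the shifts \<open>e j\<close> below are nonnegative.\<close>
    obtain i where i: "v i \<noteq> 0" and max: "\<And>j. v j \<noteq> 0 \<Longrightarrow> d j \<le> d i"
    proof -
      have "Max (d ` J) \<in> d ` J" using \<open>J \<noteq> {}\<close> by (intro Max_in) auto
      then obtain i where "i \<in> J" "Max (d ` J) = d i" by auto
      moreover have "d j \<le> Max (d ` J)" if "j \<in> J" for j using that by (intro Max_ge) auto
      ultimately show ?thesis using that by (auto simp: J_def)
    qed
    \<comment> \<open>If \<open>d i = 0\<close>, every row in the relation is constant, so
      \<open>v\<close> is a linear relation between the rows of the invertible matrix
      \<open>eval_mat B 1\<close>. Positivity makes \<open>d i - 1\<close> a true decrease.\<close>
    have di: "0 < d i"
    proof (rule ccontr)
      assume "\<not> 0 < d i"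
      then have d0: "d j = 0" if "v j \<noteq> 0" for j using max[OF that] by simp
      have ev: "v j * eval_mat B 1 $ j $ c = v j * coeff_mat B (d j) $ j $ c" for j c
      proof (cases "v j = 0")
        case False
        have "eval_mat B 1 = (\<Sum>k\<in>insert 0 {k. coeff_mat B k \<noteq> 0}. coeff_mat B k)"
          by (rule eval_mat_1) (auto simp: finite_coeff_mat_support)
        then have "eval_mat B 1 $ j $ c = (\<Sum>k\<in>insert 0 {k. coeff_mat B k \<noteq> 0}. coeff_mat B k $ j $ c)"
          by simp
        also have "\<dots> = (\<Sum>k\<in>{0}. coeff_mat B k $ j $ c)"
        proof (rule sum.mono_neutral_right)
          have "coeff_mat B k $ j $ c = 0" if "k \<noteq> 0" for k
            using d[of k j c] Bneg[of k j c] d0[OF False] that by fastforce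
          then show "\<forall>k\<in>insert 0 {k. coeff_mat B k \<noteq> 0} - {0}. coeff_mat B k $ j $ c = 0"
            by blast
        qed (auto simp: finite_coeff_mat_support)
        finally show ?thesis using d0[OF False] by simp
      qed simp
      have "eval_mat A 1 ** eval_mat B 1 = mat 1"
        by (simp add: eval_mat_1_mult[symmetric] AB eval_mat_1_one)
      then have BA: "eval_mat B 1 ** eval_mat A 1 = mat 1"
        by (simp add: matrix_left_right_inverse)
      have "(\<chi> j. v j) v* eval_mat B 1 = 0"
        using rel by (simp add: vector_matrix_mult_def vec_eq_iff mult.commute ev[symmetric])
      then have "(\<chi> j. v j) v* (eval_mat B 1 ** eval_mat A 1) = 0"
        by (simp add: vector_matrix_mul_assoc[symmetric])
      then have "(\<chi> j. v j) = 0" by (simp add: BA)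
      then show False using v(2) by (simp add: vec_eq_iff)
    qed
    define J' where "J' = J - {i}"
    \<comment> \<open>Division by \<open>v i\<close> gives row \<open>i\<close> itself the
      coefficient 1; the shifts \<open>e j\<close> align the other bounds with
      \<open>d i\<close>.\<close>
    define u where "u j = v j / v i" for j
    define e where "e j = int (d i) - int (d j)" for j
    define X where "X = row_op i J' u e"
    define d' where "d' = d(i := d i - 1)"
    have u: "u j \<in> F \<and> 0 \<le> e j" if "j \<in> J'" for j
      using v(1)[of i] v(1)[of j] max[of j] that F
      by (auto simp: u_def e_def J'_def J_def divide_inverse conj_subfield_def)
    have iJ: "i \<notin> J'" "finite J'" by (auto simp: J'_def)
    have XX: "X ** X = 0" unfolding X_def by (rule row_op_mult_row_op[OF iJ(1)])
    have X: "X \<in> poly_over F" unfolding X_def row_op_def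
      using u F by (intro poly_over_sum_monom) (auto simp: elem_mat_gl)
    have XB: "coeff_mat (X ** B) k $ r $ c =
        (if r = i then \<Sum>j\<in>J'. u j * coeff_mat B (k - e j) $ j $ c else 0)" for k r c
      by (simp add: X_def row_op_def matrix_sum_rdistrib coeff_mat_sum_distrib
          coeff_mat_monom_mult elem_mat_mult_nth)
    \<comment> \<open>Replacing \<open>B\<close> by \<open>(I + X) B\<close> and \<open>A\<close> by
      \<open>A (I - X)\<close> keeps the product equal to I.\<close>
    have B': "B + X ** B \<in> poly_over F" using X B F by (intro poly_over_add poly_over_mult)
    have A': "A - A ** X \<in> poly_over F" using X A F by (intro poly_over_diff poly_over_mult)
    have A'B': "(A - A ** X) ** (B + X ** B) = mat 1"
    proof -
      have "(A - A ** X) ** (B + X ** B) = A ** B - A ** (X ** X) ** B"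
        by (simp add: matrix_diff_rdistrib matrix_add_ldistrib matrix_mul_assoc)
      then show ?thesis by (simp add: XX AB)
    qed
    \<comment> \<open>At degree \<open>d i\<close> the new row is the relation divided by
      \<open>v i\<close>; above it, row \<open>i\<close> and all shifted rows have no
      coefficients.\<close>
    have i_row: "coeff_mat (B + X ** B) k $ i $ c = 0" if "int (d i) \<le> k" for k c
    proof (cases "k = int (d i)")
      case True
      have "0 = (\<Sum>j\<in>UNIV. v j * coeff_mat B (d j) $ j $ c) / v i" by (simp add: rel)
      also have "\<dots> = (\<Sum>j\<in>UNIV. u j * coeff_mat B (d j) $ j $ c)"
        by (simp add: sum_divide_distrib u_def)
      also have "\<dots> = (\<Sum>j\<in>J. u j * coeff_mat B (d j) $ j $ c)"
        by (rule sum.mono_neutral_right) (auto simp: J_def u_def)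
      also have "\<dots> = u i * coeff_mat B (d i) $ i $ c + (\<Sum>j\<in>J'. u j * coeff_mat B (d j) $ j $ c)"
        unfolding J'_def using i by (intro sum.remove) (auto simp: J_def)
      also have "\<dots> = coeff_mat (B + X ** B) k $ i $ c"
        using i by (simp add: XB True e_def u_def)
      finally show ?thesis by simp
    next
      case False
      have "coeff_mat B k $ i $ c = 0" using d[of k i c] that False by fastforce
      moreover have "coeff_mat B (k - e j) $ j $ c = 0" for j
        using d[of "k - e j" j c] that False by (fastforce simp: e_def)
      ultimately show ?thesis by (simp add: XB)
    qed
    have bound: "k \<le> int (d' r)" if "coeff_mat (B + X ** B) k $ r $ c \<noteq> 0" for k r c
    proof (cases "r = i")
      case True
      then show ?thesis using i_row[of k c] that di by (force simp: d'_def)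
    next
      case False
      then show ?thesis using d[of k r c] that by (simp add: XB d'_def)
    qed
    have "(\<Sum>j\<in>UNIV. d' j) < (\<Sum>j\<in>UNIV. d j)"
      by (rule sum_strict_mono_ex1) (use di in \<open>auto simp: d'_def intro!: exI[of _ i]\<close>)
    then have "B + X ** B \<in> L_const_products F"
      using less.hyps A' B' A'B' bound by blast
    \<comment> \<open>The row operation is undone by \<open>I - X\<close>, which is again a row
      operation.\<close>
    moreover have neg: "- u j \<in> F \<and> 0 \<le> e j" if "j \<in> J'" for j
      using u[OF that] F by (simp add: conj_subfield_def)
    ultimately have "(mat 1 + row_op i J' (\<lambda>j. - u j) e) ** (B + X ** B) \<in> L_const_products F"
      using iJ F by (intro L_const_products_row_op) auto
    moreover have "row_op i J' (\<lambda>j. - u j) e = - X"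
    proof -
      have "monom_mat (elem_mat i j (- a)) k = - monom_mat (elem_mat i j a) k" for j a k
        by (simp add: vec_eq_iff monom_mat_def elem_mat_def single_uminus)
      then show ?thesis by (simp add: row_op_def X_def sum_negf)
    qed
    moreover have "(mat 1 - X) ** (B + X ** B) = B - (X ** X) ** B"
      by (simp add: matrix_diff_rdistrib matrix_add_ldistrib matrix_mul_assoc)
    ultimately show ?thesis by (simp add: XX)
  qed
qed

section \<open>Indexed products and the factorization of pairs\<close>

lemma L_products_desc_prod:
  assumes "X \<in> L_products F"
  shows "\<exists>r \<kappa> N. (\<forall>i\<in>{1..r}. 0 < \<kappa> i \<and> N i \<in> gl F \<and> N i ** N i = 0) \<and>
    X = desc_prod (\<lambda>i. L_factor (N i) (\<kappa> i)) r"
  using assms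
proof induction
  case one
  show ?case by (rule exI[of _ 0]) simp
next
  case (L N k X)
  then obtain r \<kappa> N' where IH: "\<forall>i\<in>{1..r}. 0 < \<kappa> i \<and> N' i \<in> gl F \<and> N' i ** N' i = 0"
    "X = desc_prod (\<lambda>i. L_factor (N' i) (\<kappa> i)) r" by blast
  \<comment> \<open>Only indices up to \<open>n\<close> matter, so the data at \<open>Suc r\<close>
    can be set to the new factor without changing the earlier product.\<close>
  have cong: "desc_prod M n = desc_prod M' n" if "\<And>i. i \<le> n \<Longrightarrow> M i = M' i"
    for M M' :: "nat \<Rightarrow> laurent ^ 'a ^ 'a" and n
    using that by (induction n) auto
  have "desc_prod (\<lambda>i. L_factor (N' i) (\<kappa> i)) r =
      desc_prod (\<lambda>i. L_factor ((N'(Suc r := N)) i) ((\<kappa>(Suc r := k)) i)) r"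
    by (rule cong) auto
  then have "L_factor N k ** X =
      desc_prod (\<lambda>i. L_factor ((N'(Suc r := N)) i) ((\<kappa>(Suc r := k)) i)) (Suc r)"
    by (simp add: IH(2))
  moreover have "\<forall>i\<in>{1..Suc r}. 0 < (\<kappa>(Suc r := k)) i \<and> (N'(Suc r := N)) i \<in> gl F \<and>
      (N'(Suc r := N)) i ** (N'(Suc r := N)) i = 0"
    using IH(1) L.hyps by auto
  ultimately show ?case by blast
qed

text \<open>The adjoint reverses the \<open>R\<close> product and turns its factors into inverses of
  the \<open>L\<close> factors, so the pairs cancel from the inside outwards.\<close>

lemma desc_prod_L_R_inverse:
  assumes "\<forall>i\<in>{1..r}. N i ** N i = 0"
  shows "desc_prod (\<lambda>i. L_factor (N i) (\<kappa> i)) r ** adjoint_mat (desc_prod (\<lambda>i. R_factor (N i) (\<kappa> i)) r) = mat 1"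
    and "adjoint_mat (desc_prod (\<lambda>i. R_factor (N i) (\<kappa> i)) r) ** desc_prod (\<lambda>i. L_factor (N i) (\<kappa> i)) r = mat 1"
proof -
  have "desc_prod (\<lambda>i. L_factor (N i) (\<kappa> i)) r ** adjoint_mat (desc_prod (\<lambda>i. R_factor (N i) (\<kappa> i)) r) = mat 1 \<and>
    adjoint_mat (desc_prod (\<lambda>i. R_factor (N i) (\<kappa> i)) r) ** desc_prod (\<lambda>i. L_factor (N i) (\<kappa> i)) r = mat 1"
    using assms
  proof (induction r)
    case 0
    have "adjoint_mat (mat 1) = (mat 1 :: laurent ^ 'a ^ 'a)"
      by (rule coeff_mat_eqI) (simp add: coeff_adjoint coeff_mat_one)
    then show ?case by simp
  next
    case (Suc r)
    let ?N = "N (Suc r)" and ?k = "\<kappa> (Suc r)"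
    have "?N ** ?N = 0" "(- ?N) ** (- ?N) = 0"
      using Suc.prems by (auto simp: matrix_matrix_mult_def)
    then have inv: "L_factor ?N ?k ** L_factor (- ?N) ?k = mat 1" "L_factor (- ?N) ?k ** L_factor ?N ?k = mat 1"
      using L_factor_mult_inverse[of ?N] L_factor_mult_inverse[of "- ?N"] by auto
    have IH: "desc_prod (\<lambda>i. L_factor (N i) (\<kappa> i)) r ** adjoint_mat (desc_prod (\<lambda>i. R_factor (N i) (\<kappa> i)) r) = mat 1"
      "adjoint_mat (desc_prod (\<lambda>i. R_factor (N i) (\<kappa> i)) r) ** desc_prod (\<lambda>i. L_factor (N i) (\<kappa> i)) r = mat 1"
      using Suc by auto
    show ?case
      unfolding desc_prod.simps adjoint_mult adjoint_R_factor
      using IH inv by (blast intro: matrix_mult_nested_inverse)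
  qed
  then show "desc_prod (\<lambda>i. L_factor (N i) (\<kappa> i)) r ** adjoint_mat (desc_prod (\<lambda>i. R_factor (N i) (\<kappa> i)) r) = mat 1"
    and "adjoint_mat (desc_prod (\<lambda>i. R_factor (N i) (\<kappa> i)) r) ** desc_prod (\<lambda>i. L_factor (N i) (\<kappa> i)) r = mat 1"
    by auto
qed

text \<open>A single bound on the degrees in \<open>B\<close> serves all rows at the start of the
  reduction. Every \<open>L_N\<close> evaluates to I at 1, which forces the constant factor of
  \<open>B\<close> to be I; inverting \<open>B\<close> then gives \<open>A\<close>.\<close>

lemma pseudoidentity_in_L_products:
  assumes F: "conj_subfield F" and A: "A \<in> poly_over F" and B: "B \<in> poly_over F"
    and AB: "A ** B = mat 1" and ev: "eval_mat B 1 = mat 1"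
  shows "A \<in> L_products F"
proof -
  define m where "m = Max (insert 0 {k. coeff_mat B k \<noteq> 0})"
  have m: "k \<le> int (nat m)" if "coeff_mat B k $ j $ c \<noteq> 0" for k j c
  proof -
    have "coeff_mat B k \<noteq> 0" using that by auto
    then have "k \<le> m" unfolding m_def by (intro Max_ge) (auto simp: finite_coeff_mat_support)
    then show ?thesis by simp
  qed
  have "B \<in> L_const_products F"
    by (rule right_invertible_in_L_const_products[OF F A B AB m])
  then obtain P g where P: "P \<in> L_products F" "B = P ** monom_mat g 0"
    by (auto simp: L_const_products_def)
  have "g = mat 1"
    using ev by (simp add: P eval_mat_1_mult eval_mat_1_monom eval_mat_1_L_products[OF P(1)])
  then have "B = P" by (simp add: P(2) mat_one_eq_monom[symmetric])
  then obtain Y where Y: "Y \<in> L_products F" "B ** Y = mat 1"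
    using L_products_inverse[OF F P(1)] by blast
  then show ?thesis using matrix_left_inverse_eq_right_inverse[OF AB Y(2)] by simp
qed

theorem theorem3p1:
  fixes F :: "complex set" and kd kc :: int
    and C D :: "laurent ^ 'n ^ 'n"
    and Cc Dc :: "int \<Rightarrow> complex ^ 'n ^ 'n"
  assumes "conj_subfield F"
    and "CARD('n) \<ge> 2"
    and "kd < 0" and "0 < kc"
    and "\<forall>k\<in>{0..kc}. Cc k \<in> gl F"
    and "\<forall>k\<in>{kd..0}. Dc k \<in> gl F"
    and "C = (\<Sum>k\<in>{0..kc}. monom_mat (Cc k) (- k))"
    and "D = (\<Sum>k\<in>{kd..0}. monom_mat (Dc k) (- k))"
  shows "pseudoidentity_pair F C D \<longleftrightarrow>
    (\<exists>(r::nat) (\<kappa> :: nat \<Rightarrow> int) (N :: nat \<Rightarrow> complex ^ 'n ^ 'n).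
       0 < r \<and>
       (\<forall>i\<in>{1..r}. 0 < \<kappa> i \<and> N i \<in> gl F \<and> N i ** N i = 0) \<and>
       C = desc_prod (\<lambda>i. L_factor (N i) (\<kappa> i)) r \<and>
       D = desc_prod (\<lambda>i. R_factor (N i) (\<kappa> i)) r)"
proof
  assume pair: "pseudoidentity_pair F C D"
  let ?B = "adjoint_mat D"
  have CB: "C ** ?B = mat 1" and evD: "eval_mat D 1 = mat 1"
    using pair by (auto simp: pseudoidentity_pair_def)
  have C: "C \<in> poly_over F"
    unfolding assms(7) using assms by (intro poly_over_sum_monom) auto
  \<comment> \<open>The double negation gives the form required by
    \<open>poly_over_sum_monom\<close>, with \<open>- k\<close> as the nonnegative exponent of
    w.\<close>
  have "?B = (\<Sum>k\<in>{kd..0}. monom_mat (ctrans (Dc k)) (- (- k)))"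
    unfolding assms(8) by (subst adjoint_mat_sum) auto
  also have "\<dots> \<in> poly_over F"
    using assms by (intro poly_over_sum_monom) (auto intro: gl_ctrans)
  finally have B: "?B \<in> poly_over F" .
  have "C \<in> L_products F"
    by (rule pseudoidentity_in_L_products[OF assms(1) C B CB]) (simp add: eval_mat_1_adjoint evD)
  \<comment> \<open>This trivial factor replaces the empty product, since \<open>r\<close> must be
    positive.\<close>
  moreover have "L_factor 0 1 = (mat 1 :: laurent ^ 'n ^ 'n)"
    by (simp add: L_factor_def mat_one_eq_monom[symmetric])
  ultimately obtain r \<kappa> N where rN: "0 < r" "\<forall>i\<in>{1..r}. 0 < \<kappa> i \<and> N i \<in> gl F \<and> N i ** N i = 0"
    "C = desc_prod (\<lambda>i. L_factor (N i) (\<kappa> i)) r"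
  proof -
    assume L0: "L_factor 0 1 = (mat 1 :: laurent ^ 'n ^ 'n)"
    obtain r \<kappa> N where *: "\<forall>i\<in>{1..r}. 0 < \<kappa> i \<and> N i \<in> gl F \<and> N i ** N i = 0"
      "C = desc_prod (\<lambda>i. L_factor (N i) (\<kappa> i)) r"
      using L_products_desc_prod[OF \<open>C \<in> L_products F\<close>] by blast
    show ?thesis
    proof (cases "r = 0")
      case True
      then show ?thesis
        using * L0 assms(1) by (intro that[of 1 "\<lambda>_. 1" "\<lambda>_. 0"]) (auto simp: gl_0)
    next
      case False
      then show ?thesis using * that by blast
    qed
  qed
  let ?R = "desc_prod (\<lambda>i. R_factor (N i) (\<kappa> i)) r"
  \<comment> \<open>The adjoint of \<open>?R\<close> is a left inverse of \<open>C\<close> and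
    \<open>?B\<close> a right inverse, so they agree; taking adjoints again identifies
    \<open>D\<close>.\<close>
  have "adjoint_mat ?R ** C = mat 1"
    using rN desc_prod_L_R_inverse(2)[of r N \<kappa>] by auto
  then have "adjoint_mat ?R = ?B"
    by (rule matrix_left_inverse_eq_right_inverse) (rule CB)
  then have "D = ?R" by (metis adjoint_adjoint)
  then show "\<exists>(r::nat) (\<kappa> :: nat \<Rightarrow> int) (N :: nat \<Rightarrow> complex ^ 'n ^ 'n).
       0 < r \<and>
       (\<forall>i\<in>{1..r}. 0 < \<kappa> i \<and> N i \<in> gl F \<and> N i ** N i = 0) \<and>
       C = desc_prod (\<lambda>i. L_factor (N i) (\<kappa> i)) r \<and>
       D = desc_prod (\<lambda>i. R_factor (N i) (\<kappa> i)) r"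
    using rN by blast
next
  assume "\<exists>(r::nat) (\<kappa> :: nat \<Rightarrow> int) (N :: nat \<Rightarrow> complex ^ 'n ^ 'n).
       0 < r \<and>
       (\<forall>i\<in>{1..r}. 0 < \<kappa> i \<and> N i \<in> gl F \<and> N i ** N i = 0) \<and>
       C = desc_prod (\<lambda>i. L_factor (N i) (\<kappa> i)) r \<and>
       D = desc_prod (\<lambda>i. R_factor (N i) (\<kappa> i)) r"
  then obtain r \<kappa> and N :: "nat \<Rightarrow> complex ^ 'n ^ 'n"
    where rN: "\<forall>i\<in>{1..r}. N i ** N i = 0"
      and C: "C = desc_prod (\<lambda>i. L_factor (N i) (\<kappa> i)) r"
      and D: "D = desc_prod (\<lambda>i. R_factor (N i) (\<kappa> i)) r" by blast
  have ev: "eval_mat (desc_prod M n) 1 = mat 1" if "\<And>i. eval_mat (M i) 1 = mat 1"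
    for M :: "nat \<Rightarrow> laurent ^ 'n ^ 'n" and n
    by (induction n) (auto simp: eval_mat_1_one eval_mat_1_mult that)
  have "C ** adjoint_mat D = mat 1"
    unfolding C D by (rule desc_prod_L_R_inverse(1)[OF rN])
  moreover have "eval_mat C 1 = mat 1" "eval_mat D 1 = mat 1"
    unfolding C D by (rule ev, simp add: eval_mat_1_L eval_mat_1_R)+
  \<comment> \<open>The given bounds and coefficient families witness the shape required of a
    pair.\<close>
  moreover have "kd \<le> 0 \<and> 0 \<le> kc" using assms by simp
  ultimately show "pseudoidentity_pair F C D"
    unfolding pseudoidentity_pair_def using assms(5-8) by blast
qed

end
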